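(* Let $\theta\in\mathbb R\setminus\{0\}$, let $X_1,\dots,X_n\in\mathcal D$ be real random variables and let $p_1,\dots,p_n>0$ with $\sum_k p_k=1$. Let $X$ be drawn from the mixture $(p_k,X_k)_{k=1}^n$. Then $$\min_k l^\theta(X_k)\le l^\theta(X)\le\sum_{k=1}^n p_k\, l^\theta(X_k).$$
   Context: $\mathcal D$ denotes the class of (one- or multi-dimensional) random variables with strictly positive-definite Lebesgue density, together with the limiting case of an atom at $0$; their characteristic functions $\varphi_X(\theta)=\mathbb E[e^{i\theta X}]$ are real-valued and strictly positive. $l^\theta(X):=-\frac{2}{\theta^2}\ln\mathbb E[e^{i\theta X}]$. "$X$ is drawn from the mixture $(p_k,X_k)_{k=1}^n$" means that $X$ equals $X_k$ with probability $p_k$, i.e. the law of $X$ is $\sum_k p_k\,\mathrm{Law}(X_k)$ and $\varphi_X=\sum_k p_k\varphi_{X_k}$. *)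

theory Defs
  imports "HOL-Probability.Probability"
begin

text \<open>
  The coefficients range over the complex numbers, so that for real-valued \<open>f\<close> the condition
  also forces \<open>f\<close> to be even.
\<close>

definition strictly_positive_definite :: "(real \<Rightarrow> real) \<Rightarrow> bool" where
  "strictly_positive_definite f \<longleftrightarrow>
     (\<forall>S (c :: real \<Rightarrow> complex). finite S \<longrightarrow> (\<exists>x\<in>S. c x \<noteq> 0) \<longrightarrow>
        (let q = (\<Sum>x\<in>S. \<Sum>y\<in>S. c x * cnj (c y) * complex_of_real (f (x - y)))
         in q \<in> \<real> \<and> 0 < Re q))"

text \<open>
  The class \<open>\<D>\<close> of real random variables. Strict positivity of the characteristic function is
  stated separately because the finite quadratic form condition alone does not give it: the
  density \<open>(1 - cos x) / (pi * x^2)\<close> is strictly positive-definite, but its characteristic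
  function vanishes outside \<open>{-1<..<1}\<close>.
\<close>

definition class_D :: "'a measure \<Rightarrow> ('a \<Rightarrow> real) \<Rightarrow> bool" where
  "class_D M X \<longleftrightarrow>
     prob_space M \<and> X \<in> borel_measurable M \<and>
     ((\<exists>f. (\<forall>x. 0 \<le> f x) \<and> distributed M lborel X (\<lambda>x. ennreal (f x)) \<and>
           strictly_positive_definite f)
      \<or> distr M borel X = return borel 0) \<and>
     (\<forall>u. char (distr M borel X) u \<in> \<real> \<and> 0 < Re (char (distr M borel X) u))"

text \<open>
  The real part makes the logarithm the real one; nothing is lost for real-valued characteristic
  functions, hence on \<open>\<D>\<close> and for mixtures of its members.
\<close>

definition l_theta :: "real \<Rightarrow> 'a measure \<Rightarrow> ('a \<Rightarrow> real) \<Rightarrow> real" where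
  "l_theta \<theta> M X = - (2 / \<theta>\<^sup>2) * ln (Re (char (distr M borel X) \<theta>))"

definition drawn_from_mixture ::
    "'b measure \<Rightarrow> ('b \<Rightarrow> real) \<Rightarrow> nat \<Rightarrow> (nat \<Rightarrow> real) \<Rightarrow> (nat \<Rightarrow> 'a measure) \<Rightarrow> (nat \<Rightarrow> 'a \<Rightarrow> real) \<Rightarrow> bool"
  where
  "drawn_from_mixture N Y n p M X \<longleftrightarrow>
     prob_space N \<and> Y \<in> borel_measurable N \<and>
     (\<forall>A\<in>sets borel. measure (distr N borel Y) A =
        (\<Sum>k=1..n. p k * measure (distr (M k) borel (X k)) A))"

end

theory Submission
  imports Defs
begin

text \<open>
  Integrals are affine in the law, so the characteristic function of the mixture is the convex
  combination of those of the components. The upper bound is then concavity of the logarithm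
  (Jensen), and the lower bound holds because a convex combination is at most the largest term.
\<close>

text \<open>The hypothesis concerns only the measures of sets. It identifies \<open>P\<close> with
  the monadic bind of the weights, taken as a point measure on \<open>A\<close>, along the kernel
  \<open>Q\<close>: first pick an index, then sample from \<open>Q k\<close>. Integrating against a
  bind is iterated integration, and the outer integral is a finite sum.\<close>

lemma integral_finite_mixture:
  fixes P :: "'a measure" and Q :: "'i \<Rightarrow> 'a measure" and p :: "'i \<Rightarrow> real" and f :: "'a \<Rightarrow> real"
  assumes "finite A" and "A \<noteq> {}" and P: "finite_measure P"
    and Q: "\<And>k. k \<in> A \<Longrightarrow> prob_space (Q k)"
    and sets_Q: "\<And>k. k \<in> A \<Longrightarrow> sets (Q k) = sets P"
    and p: "\<And>k. k \<in> A \<Longrightarrow> 0 \<le> p k"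
    and mixture: "\<And>B. B \<in> sets P \<Longrightarrow> measure P B = (\<Sum>k\<in>A. p k * measure (Q k) B)"
    and f: "f \<in> borel_measurable P" "\<And>x. x \<in> space P \<Longrightarrow> \<bar>f x\<bar> \<le> C"
  shows "integral\<^sup>L P f = (\<Sum>k\<in>A. p k * integral\<^sup>L (Q k) f)"
proof -
  interpret finite_measure P by (fact P)
  let ?W = "point_measure A p"
  \<comment> \<open>Every subset of \<open>A\<close> is measurable for the point measure, so all
    that remains is that each \<open>Q k\<close> is a subprobability on the sets of
    \<open>P\<close>.\<close>
  have kernel: "Q \<in> measurable ?W (subprob_algebra P)"
    using Q sets_Q by (auto simp: space_subprob_algebra prob_space_imp_subprob_space)
  have space_W: "space ?W = A" by (simp add: space_point_measure)
  have "P = ?W \<bind> Q"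
  proof (rule measure_eqI)
    show "sets P = sets (?W \<bind> Q)"
      by (rule sets_bind[symmetric]) (use sets_Q \<open>A \<noteq> {}\<close> space_W in auto)
    fix B assume B: "B \<in> sets P"
    have "emeasure (?W \<bind> Q) B = (\<integral>\<^sup>+k. emeasure (Q k) B \<partial>?W)"
      using \<open>A \<noteq> {}\<close> space_W by (intro emeasure_bind[OF _ kernel B]) auto
    also have "\<dots> = (\<Sum>k\<in>A. ennreal (p k) * emeasure (Q k) B)"
      using \<open>finite A\<close> by (subst nn_integral_point_measure_finite) (simp_all add: mult.commute)
    \<comment> \<open>Since \<open>ennreal\<close> sends negative reals to 0, it commutes with these
      products and sums because the weights are nonnegative.\<close>
    also have "\<dots> = (\<Sum>k\<in>A. ennreal (p k * measure (Q k) B))"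
    proof (rule sum.cong[OF refl])
      fix k assume k: "k \<in> A"
      interpret Q: prob_space "Q k" by (rule Q[OF k])
      show "ennreal (p k) * emeasure (Q k) B = ennreal (p k * measure (Q k) B)"
        by (simp add: Q.emeasure_eq_measure ennreal_mult p[OF k])
    qed
    also have "\<dots> = ennreal (measure P B)"
      by (simp add: sum_ennreal p mixture[OF B])
    finally show "emeasure P B = emeasure (?W \<bind> Q) B"
      by (simp add: emeasure_eq_measure)
  qed
  moreover have "integral\<^sup>L (?W \<bind> Q) f = (\<integral>k. integral\<^sup>L (Q k) f \<partial>?W)"
  \<comment> \<open>Boundedness of \<open>f\<close>, finiteness of the weight measure and the common
    bound \<open>B' = 1\<close> on the masses of the \<open>Q k\<close> justify exchanging the
    integrals.\<close>
  proof (rule integral_bind[OF f kernel, where B' = 1])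
    show "finite_measure ?W"
      using \<open>finite A\<close>
      by (intro finite_measureI) (simp add: space_W emeasure_point_measure_finite)
    show "AE k in ?W. emeasure (Q k) (space (Q k)) \<le> ennreal 1"
      by (rule AE_I2) (simp add: space_W Q prob_space.emeasure_space_1)
  qed
  ultimately show ?thesis
    using \<open>finite A\<close> p by (simp add: lebesgue_integral_point_measure_finite)
qed

text \<open>Turns the complex integral defining \<open>char\<close> into one of a bounded real
  function, the form that \<open>integral_finite_mixture\<close> accepts.\<close>

lemma Re_char_eq_integral_cos:
  assumes "real_distribution \<mu>"
  shows "Re (char \<mu> t) = (\<integral>x. cos (t * x) \<partial>\<mu>)"
proof -
  interpret real_distribution \<mu> by (fact assms)
  have "integrable \<mu> (\<lambda>x. iexp (t * x))"
    using integrable_iexp[of "\<lambda>x. complex_of_real (t * x)"] by simp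
  then have "Re (char \<mu> t) = (\<integral>x. Re (iexp (t * x)) \<partial>\<mu>)"
    unfolding char_def by (rule integral_Re[symmetric])
  then show ?thesis
    by (simp add: Re_exp)
qed

text \<open>The mixture lemma applied to the cosine, bounded by 1. The condition on \<open>n\<close>
  keeps the index set nonempty, since a bind over an empty space is degenerate.\<close>

lemma Re_char_mixture:
  assumes mixture: "drawn_from_mixture N Y n p M X" and "1 \<le> n"
    and X: "\<And>k. k \<in> {1..n} \<Longrightarrow> prob_space (M k)" "\<And>k. k \<in> {1..n} \<Longrightarrow> X k \<in> borel_measurable (M k)"
    and p: "\<And>k. k \<in> {1..n} \<Longrightarrow> 0 \<le> p k"
  shows "Re (char (distr N borel Y) t) = (\<Sum>k=1..n. p k * Re (char (distr (M k) borel (X k)) t))"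
proof -
  have Y: "real_distribution (distr N borel Y)"
    using mixture by (simp add: drawn_from_mixture_def prob_space.real_distribution_distr)
  then interpret Y: real_distribution "distr N borel Y" .
  have X_distr: "real_distribution (distr (M k) borel (X k))" if "k \<in> {1..n}" for k
    using X that by (simp add: prob_space.real_distribution_distr)
  have "(\<integral>x. cos (t * x) \<partial>distr N borel Y)
      = (\<Sum>k=1..n. p k * (\<integral>x. cos (t * x) \<partial>distr (M k) borel (X k)))"
  proof (rule integral_finite_mixture[where C = 1])
    show "finite_measure (distr N borel Y)" by unfold_locales
    show "prob_space (distr (M k) borel (X k))" if "k \<in> {1..n}" for k
      using X that by (simp add: prob_space.prob_space_distr)
    show "measure (distr N borel Y) B = (\<Sum>k=1..n. p k * measure (distr (M k) borel (X k)) B)"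
      if "B \<in> sets (distr N borel Y)" for B
      using mixture that by (simp add: drawn_from_mixture_def)
  qed (use \<open>1 \<le> n\<close> p in auto)
  then show ?thesis
    by (simp add: Re_char_eq_integral_cos Y X_distr)
qed

theorem proposition7:
  fixes \<theta> :: real and n :: nat and p :: "nat \<Rightarrow> real"
    and M :: "nat \<Rightarrow> 'a measure" and X :: "nat \<Rightarrow> 'a \<Rightarrow> real"
    and N :: "'b measure" and Y :: "'b \<Rightarrow> real"
  assumes "\<theta> \<noteq> 0"
    and "\<And>k. k \<in> {1..n} \<Longrightarrow> class_D (M k) (X k)"
    and "\<And>k. k \<in> {1..n} \<Longrightarrow> 0 < p k"
    and "(\<Sum>k=1..n. p k) = 1"
    and "drawn_from_mixture N Y n p M X"
  shows "Min ((\<lambda>k. l_theta \<theta> (M k) (X k)) ` {1..n}) \<le> l_theta \<theta> N Y \<and>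
         l_theta \<theta> N Y \<le> (\<Sum>k=1..n. p k * l_theta \<theta> (M k) (X k))"
proof -
  let ?I = "{1..n}"
  define \<phi> where "\<phi> k = Re (char (distr (M k) borel (X k)) \<theta>)" for k
  define \<psi> where "\<psi> = Re (char (distr N borel Y) \<theta>)"
  have l_X: "l_theta \<theta> (M k) (X k) = - (2 / \<theta>\<^sup>2) * ln (\<phi> k)" for k
    by (simp add: l_theta_def \<phi>_def)
  have l_Y: "l_theta \<theta> N Y = - (2 / \<theta>\<^sup>2) * ln \<psi>"
    by (simp add: l_theta_def \<psi>_def)
  \<comment> \<open>An empty sum of weights would be 0 instead of 1.\<close>
  have nonempty: "?I \<noteq> {}"
    using assms(4) by force
  have \<phi>_pos: "0 < \<phi> k" if "k \<in> ?I" for k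
    using assms(2)[OF that] by (simp add: class_D_def \<phi>_def)
  have \<psi>_eq: "\<psi> = (\<Sum>k\<in>?I. p k * \<phi> k)"
    unfolding \<psi>_def \<phi>_def
    using assms(2,3) nonempty
    by (intro Re_char_mixture[OF assms(5)]) (auto simp: class_D_def less_imp_le)
  have \<psi>_pos: "0 < \<psi>"
    unfolding \<psi>_eq using assms(3) \<phi>_pos nonempty by (intro sum_pos) auto
  \<comment> \<open>The factor \<open>- (2 / \<theta>\<^sup>2)\<close> reverses order, so an index
    maximizing \<phi> serves as the witness that bounds the minimum of
    \<open>l_theta\<close>.\<close>
  have "Max (\<phi> ` ?I) \<in> \<phi> ` ?I"
    using nonempty by (intro Max_in) auto
  then obtain m where m: "m \<in> ?I" and "\<phi> m = Max (\<phi> ` ?I)"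
    by (metis imageE)
  then have \<phi>_le: "\<phi> k \<le> \<phi> m" if "k \<in> ?I" for k
    using that by simp
  have "\<psi> \<le> (\<Sum>k\<in>?I. p k * \<phi> m)"
    unfolding \<psi>_eq using assms(3) \<phi>_le by (intro sum_mono mult_left_mono) (auto intro: less_imp_le)
  also have "\<dots> = \<phi> m"
    using assms(4) by (simp flip: sum_distrib_right)
  finally have "ln \<psi> \<le> ln (\<phi> m)"
    using \<psi>_pos by simp
  then have "l_theta \<theta> (M m) (X m) \<le> l_theta \<theta> N Y"
    unfolding l_X l_Y by (intro mult_left_mono_neg) simp_all
  moreover have "Min ((\<lambda>k. l_theta \<theta> (M k) (X k)) ` ?I) \<le> l_theta \<theta> (M m) (X m)"
    using m by (intro Min_le) auto
  ultimately have lower: "Min ((\<lambda>k. l_theta \<theta> (M k) (X k)) ` ?I) \<le> l_theta \<theta> N Y"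
    by linarith
  \<comment> \<open>Jensen applies because every \<phi> value lies in the positive half-line, where
    \<open>ln\<close> is concave.\<close>
  have "(\<Sum>k\<in>?I. p k * ln (\<phi> k)) \<le> ln \<psi>"
    using concave_on_sum[OF _ nonempty ln_concave assms(4), of \<phi>] assms(3) \<phi>_pos
    by (simp add: \<psi>_eq less_imp_le)
  then have "l_theta \<theta> N Y \<le> - (2 / \<theta>\<^sup>2) * (\<Sum>k\<in>?I. p k * ln (\<phi> k))"
    unfolding l_Y by (intro mult_left_mono_neg) simp_all
  also have "\<dots> = (\<Sum>k\<in>?I. p k * l_theta \<theta> (M k) (X k))"
    unfolding l_X sum_distrib_left by (intro sum.cong) (simp_all add: mult_ac)
  finally show ?thesis
    using lower by blast
qed

end
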